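(* Let $T$ be a tree and $k$ a field. For every maximum matching $M$ of $T$ and every family of invertible parameters $\alpha=(\alpha_i)_{i\in T}$ in $k^\times$, there exist unique parameters $\beta=(\beta_i)_{i\in T}$ (given by monic Laurent monomials in $\alpha$) such that: (1) $\beta_i=1$ except on the set of red vertices $i$ not covered by $M$; (2) $X_T(\alpha)$ is isomorphic to $X_T(\beta)$ by a sequence of jumps. Moreover: (a) the function $\beta$ only depends on the values of $\alpha$ on the red vertices of $T$; (b) the values of $\beta$ on a red-green component are Laurent monomials in the values of $\alpha$ on the same red-green component.
   Context: A tree is a finite connected simply-connected graph. A vertex cover of a tree $T$ is a set of vertices meeting every edge; a minimum vertex cover is one of minimal cardinality. Canonical coloring: a vertex of $T$ is green if it lies in all minimum vertex covers, orange if it lies in some but not all, red if it lies in none. A matching of $T$ is a set of edges (dominoes) such that every vertex lies in at most one of them; a maximum matching is one of maximal cardinality. Known fact: every maximum matching covers all orange and green vertices, and each orange vertex is matched with the same orange vertex (its matched orange neighbor) in all maximum matchings. The red-green components of $T$ are the connected components of the graph whose vertices are the red and green vertices of $T$ and whose edges are the edges of $T$ with one red end and one green end. For invertible values $\alpha=(\alpha_i)_{i\in T}$, $X_T(\alpha)$ is the affine scheme with variables $x_i,x'_i$ for all vertices $i$ of $T$, defined by the equations $x_ix'_i=1+\alpha_i\prod_j x_j$ for all $i$, the product being over the vertices $j$ adjacent to $i$. Jumps: let $u-v$ be an edge of $T$ such that either $u$ is red and $v$ is green, or $u$ is green and $v$ is red, or $u$ is orange and $v$ is its matched orange neighbor.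 The jump of $u$ over $v$ replaces $\alpha$ by $\beta$, where $\beta_w=\alpha_w/\alpha_u$ if $w$ is a neighbor of $v$ (in particular $\beta_u=1$), and $\beta_w=\alpha_w$ otherwise; it comes with the isomorphism between $X_T(\alpha)$ and $X_T(\beta)$ obtained by rescaling $x_v$ by $\alpha_u$ and $x'_v$ by $\alpha_u^{-1}$, all other variables being unchanged. *)

theory Defs
  imports "HOL-Library.Poly_Mapping" "HOL-Algebra.QuotRing" "HOL-Algebra.Algebraic_Closure_Type"
begin

section \<open>Trees\<close>

text \<open>
  A graph has all of the finite type \<open>'v\<close> as vertex set and is given by its set \<open>E\<close> of
  two-element edges. Loops and multiple edges can be left out since a simply connected graph has
  none; for the same reason, simple connectedness is the absence of cycles.
\<close>

definition neighbors :: "'v set set \<Rightarrow> 'v \<Rightarrow> 'v set" where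
  "neighbors E v = {w. {v, w} \<in> E}"

definition connected_graph :: "'v set set \<Rightarrow> bool" where
  "connected_graph E \<longleftrightarrow> (\<forall>u v. (u, v) \<in> {(a, b). {a, b} \<in> E}\<^sup>*)"

definition cycle_in :: "'v set set \<Rightarrow> 'v list \<Rightarrow> bool" where
  "cycle_in E p \<longleftrightarrow> 3 \<le> length p \<and> distinct p \<and>
     (\<forall>i<length p. {p ! i, p ! (Suc i mod length p)} \<in> E)"

definition is_tree :: "'v::finite set set \<Rightarrow> bool" where
  "is_tree E \<longleftrightarrow> (\<forall>e\<in>E. card e = 2) \<and> connected_graph E \<and> (\<nexists>p. cycle_in E p)"

section \<open>Canonical coloring and matchings\<close>

definition vertex_cover :: "'v::finite set set \<Rightarrow> 'v set \<Rightarrow> bool" where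
  "vertex_cover E C \<longleftrightarrow> (\<forall>e\<in>E. e \<inter> C \<noteq> {})"

definition min_vertex_cover :: "'v::finite set set \<Rightarrow> 'v set \<Rightarrow> bool" where
  "min_vertex_cover E C \<longleftrightarrow> vertex_cover E C \<and> (\<forall>D. vertex_cover E D \<longrightarrow> card C \<le> card D)"

definition green :: "'v::finite set set \<Rightarrow> 'v \<Rightarrow> bool" where
  "green E v \<longleftrightarrow> (\<forall>C. min_vertex_cover E C \<longrightarrow> v \<in> C)"

definition red :: "'v::finite set set \<Rightarrow> 'v \<Rightarrow> bool" where
  "red E v \<longleftrightarrow> (\<forall>C. min_vertex_cover E C \<longrightarrow> v \<notin> C)"

definition orange :: "'v::finite set set \<Rightarrow> 'v \<Rightarrow> bool" where
  "orange E v \<longleftrightarrow> (\<exists>C. min_vertex_cover E C \<and> v \<in> C) \<and> (\<exists>C. min_vertex_cover E C \<and> v \<notin> C)"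

definition matching :: "'v::finite set set \<Rightarrow> 'v set set \<Rightarrow> bool" where
  "matching E M \<longleftrightarrow> M \<subseteq> E \<and> (\<forall>d\<in>M. \<forall>e\<in>M. d \<noteq> e \<longrightarrow> d \<inter> e = {})"

definition max_matching :: "'v::finite set set \<Rightarrow> 'v set set \<Rightarrow> bool" where
  "max_matching E M \<longleftrightarrow> matching E M \<and> (\<forall>N. matching E N \<longrightarrow> card N \<le> card M)"

definition matched_orange_neighbor :: "'v::finite set set \<Rightarrow> 'v \<Rightarrow> 'v \<Rightarrow> bool" where
  "matched_orange_neighbor E u v \<longleftrightarrow>
     orange E u \<and> orange E v \<and> (\<forall>M. max_matching E M \<longrightarrow> {u, v} \<in> M)"

definition red_green_edges :: "'v::finite set set \<Rightarrow> ('v \<times> 'v) set" where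
  "red_green_edges E =
     {(u, v). {u, v} \<in> E \<and> (red E u \<and> green E v \<or> green E u \<and> red E v)}"

definition red_green_components :: "'v::finite set set \<Rightarrow> 'v set set" where
  "red_green_components E = {(red_green_edges E)\<^sup>* `` {u} | u. red E u \<or> green E u}"

section \<open>The affine scheme of a tree\<close>

text \<open>
  The polynomial ring over \<open>'k\<close> in the variables \<open>x\<^sub>i\<close> (\<open>Var i\<close>) and \<open>x'\<^sub>i\<close> (\<open>Var' i\<close>), for all
  vertices \<open>i\<close>, is the monoid algebra of finitely supported exponent vectors.
\<close>

datatype 'v coord = Var 'v | Var' 'v

type_synonym ('v, 'k) tree_poly = "('v coord \<Rightarrow>\<^sub>0 nat) \<Rightarrow>\<^sub>0 'k"

definition const :: "'k::field \<Rightarrow> ('v, 'k) tree_poly" where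
  "const c = Poly_Mapping.single 0 c"

definition var :: "'v coord \<Rightarrow> ('v, 'k::field) tree_poly" where
  "var z = Poly_Mapping.single (Poly_Mapping.single z 1) 1"

text \<open>The \<open>'k\<close>-algebra endomorphism of the polynomial ring sending each variable \<open>z\<close> to \<open>f z\<close>.\<close>

definition subst_poly ::
  "('v coord \<Rightarrow> ('v, 'k::field) tree_poly) \<Rightarrow> ('v, 'k) tree_poly \<Rightarrow> ('v, 'k) tree_poly" where
  "subst_poly f p =
     (\<Sum>m\<in>Poly_Mapping.keys p. const (Poly_Mapping.lookup p m) *
        (\<Prod>z\<in>Poly_Mapping.keys m. f z ^ Poly_Mapping.lookup m z))"

abbreviation poly_ring :: "('v, 'k::field) tree_poly ring" where
  "poly_ring \<equiv> ring_of_type_algebra"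

definition equation :: "'v::finite set set \<Rightarrow> ('v \<Rightarrow> 'k::field) \<Rightarrow> 'v \<Rightarrow> ('v, 'k) tree_poly" where
  "equation E \<alpha> i =
     var (Var i) * var (Var' i) - (1 + const (\<alpha> i) * (\<Prod>j\<in>neighbors E i. var (Var j)))"

definition tree_ideal :: "'v::finite set set \<Rightarrow> ('v \<Rightarrow> 'k::field) \<Rightarrow> ('v, 'k) tree_poly set" where
  "tree_ideal E \<alpha> = Idl\<^bsub>poly_ring\<^esub> (equation E \<alpha> ` UNIV)"

text \<open>
  The affine \<open>'k\<close>-scheme \<open>X\<^sub>T(\<alpha>)\<close> is represented by its coordinate ring, and an isomorphism
  \<open>X\<^sub>T(\<alpha>) \<rightarrow> X\<^sub>T(\<beta>)\<close> of \<open>'k\<close>-schemes by its pullback, an isomorphism of \<open>'k\<close>-algebras from the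
  coordinate ring of \<open>X\<^sub>T(\<beta>)\<close> to that of \<open>X\<^sub>T(\<alpha>)\<close>.
\<close>

definition coord_ring ::
  "'v::finite set set \<Rightarrow> ('v \<Rightarrow> 'k::field) \<Rightarrow> ('v, 'k) tree_poly set ring" where
  "coord_ring E \<alpha> = poly_ring Quot tree_ideal E \<alpha>"

definition residue_class ::
  "'v::finite set set \<Rightarrow> ('v \<Rightarrow> 'k::field) \<Rightarrow> ('v, 'k) tree_poly \<Rightarrow> ('v, 'k) tree_poly set" where
  "residue_class E \<alpha> p = tree_ideal E \<alpha> +>\<^bsub>poly_ring\<^esub> p"

definition scheme_iso ::
  "'v::finite set set \<Rightarrow> ('v \<Rightarrow> 'k::field) \<Rightarrow> ('v \<Rightarrow> 'k) \<Rightarrow>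
   (('v, 'k) tree_poly set \<Rightarrow> ('v, 'k) tree_poly set) set" where
  "scheme_iso E \<alpha> \<beta> = {h \<in> ring_iso (coord_ring E \<beta>) (coord_ring E \<alpha>).
     \<forall>c. h (residue_class E \<beta> (const c)) = residue_class E \<alpha> (const c)}"

section \<open>Jumps\<close>

definition jump_allowed :: "'v::finite set set \<Rightarrow> 'v \<Rightarrow> 'v \<Rightarrow> bool" where
  "jump_allowed E u v \<longleftrightarrow> {u, v} \<in> E \<and>
     (red E u \<and> green E v \<or> green E u \<and> red E v \<or> matched_orange_neighbor E u v)"

definition jump :: "'v::finite set set \<Rightarrow> 'v \<Rightarrow> 'v \<Rightarrow> ('v \<Rightarrow> 'k::field) \<Rightarrow> 'v \<Rightarrow> 'k" where
  "jump E u v \<alpha> = (\<lambda>w. if w \<in> neighbors E v then \<alpha> w / \<alpha> u else \<alpha> w)"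

definition jump_subst ::
  "'v::finite \<Rightarrow> 'v \<Rightarrow> ('v \<Rightarrow> 'k::field) \<Rightarrow> 'v coord \<Rightarrow> ('v, 'k) tree_poly" where
  "jump_subst u v \<alpha> z =
     (if z = Var v then const (\<alpha> u) * var z
      else if z = Var' v then const (inverse (\<alpha> u)) * var z
      else var z)"

text \<open>
  The pullback of \<open>X\<^sub>T(\<alpha>) \<rightarrow> X\<^sub>T(jump E u v \<alpha>)\<close>, which sends the class of \<open>p\<close> to the class of
  \<open>subst_poly (jump_subst u v \<alpha>) p\<close>; on classes, the union is over equal sets.
\<close>

definition jump_pullback ::
  "'v::finite set set \<Rightarrow> 'v \<Rightarrow> 'v \<Rightarrow> ('v \<Rightarrow> 'k::field) \<Rightarrow>
   ('v, 'k) tree_poly set \<Rightarrow> ('v, 'k) tree_poly set" where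
  "jump_pullback E u v \<alpha> C = (\<Union>p\<in>C. residue_class E \<alpha> (subst_poly (jump_subst u v \<alpha>) p))"

text \<open>
  \<open>jump_sequence E \<alpha> \<beta> h\<close>: some finite sequence of jumps leads from \<open>\<alpha>\<close> to \<open>\<beta>\<close>, and \<open>h\<close> is the
  pullback of the composite \<open>X\<^sub>T(\<alpha>) \<rightarrow> X\<^sub>T(\<beta>)\<close> of the maps that come with these jumps.
\<close>

inductive jump_sequence ::
  "'v::finite set set \<Rightarrow> ('v \<Rightarrow> 'k::field) \<Rightarrow> ('v \<Rightarrow> 'k) \<Rightarrow>
   (('v, 'k) tree_poly set \<Rightarrow> ('v, 'k) tree_poly set) \<Rightarrow> bool"
  for E \<alpha> where
    no_jump: "jump_sequence E \<alpha> \<alpha> id"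
  | one_more_jump: "jump_sequence E \<alpha> \<beta> h \<Longrightarrow> jump_allowed E u v \<Longrightarrow>
      jump_sequence E \<alpha> (jump E u v \<beta>) (h \<circ> jump_pullback E u v \<beta>)"

definition iso_by_jumps ::
  "'v::finite set set \<Rightarrow> ('v \<Rightarrow> 'k::field) \<Rightarrow> ('v \<Rightarrow> 'k) \<Rightarrow> bool" where
  "iso_by_jumps E \<alpha> \<beta> \<longleftrightarrow> (\<exists>h \<in> scheme_iso E \<alpha> \<beta>. jump_sequence E \<alpha> \<beta> h)"

section \<open>Parameters\<close>

definition params :: "('v \<Rightarrow> 'k::field) set" where
  "params = {\<alpha>. \<forall>i. \<alpha> i \<noteq> 0}"

text \<open>As a function on \<open>params\<close>, \<open>f\<close> is a monic Laurent monomial in the \<open>\<alpha> j\<close> with \<open>j \<in> S\<close>.\<close>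

definition monic_laurent_monomial :: "'v::finite set \<Rightarrow> (('v \<Rightarrow> 'k::field) \<Rightarrow> 'k) \<Rightarrow> bool" where
  "monic_laurent_monomial S f \<longleftrightarrow>
     (\<exists>e :: 'v \<Rightarrow> int. \<forall>\<alpha>\<in>params. f \<alpha> = (\<Prod>j\<in>S. \<alpha> j powi e j))"

definition reduced_form ::
  "'v::finite set set \<Rightarrow> 'v set set \<Rightarrow> ('v \<Rightarrow> 'k::field) \<Rightarrow> ('v \<Rightarrow> 'k) \<Rightarrow> bool" where
  "reduced_form E M \<alpha> \<beta> \<longleftrightarrow> \<beta> \<in> params \<and>
     (\<forall>i. \<not> (red E i \<and> i \<notin> \<Union>M) \<longrightarrow> \<beta> i = 1) \<and>
     iso_by_jumps E \<alpha> \<beta>"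

end

theory Submission
  imports Defs
begin

text \<open>
  By Koenig's theorem, every minimum vertex cover contains exactly one end of each edge of \<open>M\<close> and
  nothing else. So the edges of \<open>M\<close> are red-green or join matched orange neighbors, the vertices not
  covered by \<open>M\<close> are red, and every matched vertex may jump over its partner. This jump sets its own
  parameter to 1 and disturbs only the other neighbors of the partner. As alternating walks in a
  forest do not close up, the matched vertices can be ordered such that no jump disturbs a vertex
  that has already been treated. Performing all these jumps gives the normal form \<open>B\<close>.

  For uniqueness, \<open>B\<close> is multiplicative and fixes reduced parameters, so it suffices that it kills
  the parameters that are constant on the neighbors of some \<open>v\<close> and 1 elsewhere. If \<open>v\<close> is matched,
  the first effective jump is that of the partner of \<open>v\<close> over \<open>v\<close>, which gives 1 at once. Otherwise
  \<open>v\<close> is red, these parameters are 1 on all red vertices, and they stay so, because red values are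
  changed only by jumps of red vertices over green ones.
\<close>

section \<open>Polynomial substitutions and coordinate rings\<close>

lemma finite_UNIV_coord: "finite (UNIV :: 'v::finite coord set)"
proof -
  have "x \<in> range Var \<union> range Var'" for x :: "'v coord"
    by (cases x) auto
  then show ?thesis by (intro finite_subset[of UNIV "range Var \<union> range Var'"]) auto
qed

text \<open>Adapts \<open>update_induct\<close> to additive maps: at a fresh key an update is a sum,
  and freshness can then be forgotten.\<close>

lemma poly_mapping_add_induct [case_names zero add]:
  assumes "P 0" and "\<And>m c p. P p \<Longrightarrow> P (Poly_Mapping.single m c + p)"
  shows "P (p :: 'a \<Rightarrow>\<^sub>0 'b::comm_monoid_add)"
proof (induction p rule: update_induct)
  case (update f a b)
  have "Poly_Mapping.update a b f = Poly_Mapping.single a b + f"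
    using update(1) by (intro poly_mapping_eqI)
      (auto simp: lookup_update lookup_add lookup_single when_def in_keys_iff)
  then show ?case using assms(2) update by simp
qed (rule assms(1))

text \<open>The product runs over all coordinates so that addition of exponents needs no bookkeeping
  of supports; the extra factors are zeroth powers.\<close>

definition monomial_value ::
  "('v coord \<Rightarrow> ('v, 'k::field) tree_poly) \<Rightarrow> ('v coord \<Rightarrow>\<^sub>0 nat) \<Rightarrow> ('v, 'k) tree_poly" where
  "monomial_value f m = (\<Prod>z\<in>UNIV. f z ^ Poly_Mapping.lookup m z)"

lemma monomial_value_zero: "monomial_value f 0 = 1"
  by (simp add: monomial_value_def)

lemma monomial_value_add: "monomial_value f (m + n) = monomial_value f m * monomial_value f n"
  by (simp add: monomial_value_def lookup_add power_add prod.distrib)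

lemma const_zero [simp]: "const 0 = 0"
  and const_one [simp]: "const 1 = 1"
  and const_add: "const (c + d) = const c + const d"
  and const_mult: "const (c * d) = const c * const d"
  by (simp_all add: const_def single_add mult_single)

text \<open>Additivity compares sums over different supports; enlarging them to a common finite set
  makes the comparison termwise.\<close>

lemma subst_poly_eq_sum:
  fixes f :: "'v::finite coord \<Rightarrow> ('v, 'k::field) tree_poly"
  assumes "finite A" "Poly_Mapping.keys p \<subseteq> A"
  shows "subst_poly f p = (\<Sum>m\<in>A. const (Poly_Mapping.lookup p m) * monomial_value f m)"
proof -
  have "(\<Prod>z\<in>Poly_Mapping.keys m. f z ^ Poly_Mapping.lookup m z) = monomial_value f m" for m
    unfolding monomial_value_def
    by (intro prod.mono_neutral_left) (auto simp: finite_UNIV_coord in_keys_iff)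
  then show ?thesis
    unfolding subst_poly_def using assms
    by (auto intro!: sum.mono_neutral_left simp: in_keys_iff)
qed

context
  fixes f :: "'v::finite coord \<Rightarrow> ('v, 'k::field) tree_poly"
begin

lemma subst_poly_single: "subst_poly f (Poly_Mapping.single m c) = const c * monomial_value f m"
  by (subst subst_poly_eq_sum[of "{m}"]) auto

lemma subst_poly_zero [simp]: "subst_poly f 0 = 0"
  by (simp add: subst_poly_def)

lemma subst_poly_const [simp]: "subst_poly f (const c) = const c"
  using subst_poly_single[of 0 c] by (simp add: const_def[of c] monomial_value_zero)

lemma subst_poly_one [simp]: "subst_poly f 1 = 1"
  using subst_poly_const[of 1] by simp

lemma subst_poly_var [simp]: "subst_poly f (var z) = f z"
proof -
  have "f x ^ Poly_Mapping.lookup (Poly_Mapping.single z 1) x = (if x = z then f z else 1)" for x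
    by (simp add: lookup_single when_def)
  then have "monomial_value f (Poly_Mapping.single z 1) = f z"
    by (simp add: monomial_value_def finite_UNIV_coord)
  then show ?thesis by (simp add: var_def subst_poly_single)
qed

lemma subst_poly_add [simp]: "subst_poly f (p + q) = subst_poly f p + subst_poly f q"
proof -
  let ?A = "Poly_Mapping.keys p \<union> Poly_Mapping.keys q"
  have "Poly_Mapping.keys (p + q) \<subseteq> ?A" by (rule Poly_Mapping.keys_add)
  then show ?thesis
    by (simp add: subst_poly_eq_sum[of ?A] lookup_add const_add distrib_right sum.distrib)
qed

lemma subst_poly_mult [simp]: "subst_poly f (p * q) = subst_poly f p * subst_poly f q"
proof -
  \<comment> \<open>A single term on the left is treated first, where exponents just add; additivity
    extends this to all \<open>p\<close>.\<close>
  have *: "subst_poly f (Poly_Mapping.single m c * q) =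
      subst_poly f (Poly_Mapping.single m c) * subst_poly f q" for m c
    by (induction q rule: poly_mapping_add_induct)
      (simp_all add: distrib_left mult_single subst_poly_single const_mult monomial_value_add mult_ac)
  show ?thesis
    by (induction p rule: poly_mapping_add_induct) (simp_all add: distrib_right *)
qed

lemma subst_poly_uminus [simp]: "subst_poly f (- p) = - subst_poly f p"
  using subst_poly_add[of p "- p"] by (simp add: add_eq_0_iff)

lemma subst_poly_diff [simp]: "subst_poly f (p - q) = subst_poly f p - subst_poly f q"
  using subst_poly_add[of p "- q"] by simp

lemma subst_poly_prod [simp]: "subst_poly f (\<Prod>j\<in>A. g j) = (\<Prod>j\<in>A. subst_poly f (g j))"
  by (induction A rule: infinite_finite_induct) simp_all

lemma subst_poly_power [simp]: "subst_poly f (p ^ n) = subst_poly f p ^ n"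
  by (induction n) simp_all

end

lemma subst_poly_comp:
  fixes p :: "('v::finite, 'k::field) tree_poly"
  shows "subst_poly f (subst_poly g p) = subst_poly (\<lambda>z. subst_poly f (g z)) p"
  by (induction p rule: poly_mapping_add_induct)
    (simp_all add: subst_poly_single monomial_value_def)

lemma monomial_value_var: "monomial_value var (m :: 'v::finite coord \<Rightarrow>\<^sub>0 nat) = Poly_Mapping.single m 1"
proof -
  have power: "var z ^ n = Poly_Mapping.single (Poly_Mapping.single z n) 1" for z :: "'v coord" and n
    by (induction n) (simp_all add: var_def mult_single flip: single_add)
  have prod: "(\<Prod>z\<in>A. Poly_Mapping.single (g z) 1) = Poly_Mapping.single (\<Sum>z\<in>A. g z) (1 :: 'b::field)"
    for A and g :: "'v coord \<Rightarrow> 'v coord \<Rightarrow>\<^sub>0 nat"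
    by (induction A rule: infinite_finite_induct) (simp_all add: mult_single)
  have "(\<Sum>z\<in>UNIV. Poly_Mapping.single z (Poly_Mapping.lookup m z)) = m"
    by (intro poly_mapping_eqI)
      (simp add: lookup_sum lookup_single when_def finite_UNIV_coord)
  then show ?thesis by (simp add: monomial_value_def power prod)
qed

text \<open>Together with \<open>subst_poly_comp\<close>, this reduces mutual inverseness of two
  substitutions to a check on the variables.\<close>

lemma subst_poly_var_id: "subst_poly var p = (p :: ('v::finite, 'k::field) tree_poly)"
  by (induction p rule: poly_mapping_add_induct)
    (simp_all add: subst_poly_single monomial_value_var const_def mult_single)

section \<open>Coordinate rings as quotients, and their isomorphisms\<close>

lemma ring_of_type_algebra_sel [simp]:
  "carrier ring_of_type_algebra = UNIV"
  "x \<otimes>\<^bsub>ring_of_type_algebra\<^esub> y = x * y"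
  "x \<oplus>\<^bsub>ring_of_type_algebra\<^esub> y = x + y"
  "\<one>\<^bsub>ring_of_type_algebra\<^esub> = 1"
  "\<zero>\<^bsub>ring_of_type_algebra\<^esub> = 0"
  by (simp_all add: ring_of_type_algebra_def)

lemma poly_ring_cring: "cring (poly_ring :: ('v, 'k::field) tree_poly ring)"
  by (rule cring_from_type_algebra)

lemma tree_ideal_ideal:
  "ideal (tree_ideal E \<alpha>) (poly_ring :: ('v::finite, 'k::field) tree_poly ring)"
proof -
  interpret cring "poly_ring :: ('v, 'k) tree_poly ring" by (rule poly_ring_cring)
  show ?thesis unfolding tree_ideal_def by (rule genideal_ideal) simp
qed

lemma equation_in_tree_ideal:
  "equation E \<alpha> i \<in> (tree_ideal E \<alpha> :: ('v::finite, 'k::field) tree_poly set)"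
proof -
  interpret cring "poly_ring :: ('v, 'k) tree_poly ring" by (rule poly_ring_cring)
  show ?thesis unfolding tree_ideal_def using genideal_self[of "equation E \<alpha> ` UNIV"] by auto
qed

lemma tree_ideal_minimal:
  fixes I :: "('v::finite, 'k::field) tree_poly set"
  assumes "ideal I poly_ring" "\<And>i. equation E \<alpha> i \<in> I"
  shows "tree_ideal E \<alpha> \<subseteq> I"
proof -
  interpret cring "poly_ring :: ('v, 'k) tree_poly ring" by (rule poly_ring_cring)
  show ?thesis unfolding tree_ideal_def using assms by (intro genideal_minimal) auto
qed

text \<open>The preimage of \<open>tree_ideal E \<alpha>\<close> under the homomorphism
  \<open>subst_poly f\<close> is an ideal containing the generators of
  \<open>tree_ideal E \<beta>\<close>.\<close>

lemma subst_poly_tree_ideal: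
  fixes f :: "'v::finite coord \<Rightarrow> ('v, 'k::field) tree_poly"
  assumes "\<And>i. subst_poly f (equation E \<beta> i) = equation E \<alpha> i" "p \<in> tree_ideal E \<beta>"
  shows "subst_poly f p \<in> tree_ideal E \<alpha>"
proof -
  interpret cring "poly_ring :: ('v, 'k) tree_poly ring" by (rule poly_ring_cring)
  interpret I: ideal "tree_ideal E \<alpha>" "poly_ring :: ('v, 'k) tree_poly ring"
    by (rule tree_ideal_ideal)
  have hom: "ring_hom_ring (poly_ring :: ('v, 'k) tree_poly ring) poly_ring (subst_poly f)"
    by (intro ring_hom_ringI2 ring_hom_memI) (auto intro: ring_axioms)
  have "ideal {p \<in> carrier poly_ring. subst_poly f p \<in> tree_ideal E \<alpha>} poly_ring"
    by (rule ring_hom_ring.ideal_vimage[OF hom tree_ideal_ideal])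
  from tree_ideal_minimal[OF this, of E \<beta>] show ?thesis
    using assms equation_in_tree_ideal[of E \<alpha>] by auto
qed

context
  fixes E :: "'v::finite set set" and \<alpha> :: "'v \<Rightarrow> 'k::field"
begin

lemma residue_class_eq_iff:
  "residue_class E \<alpha> p = residue_class E (\<alpha> :: 'v \<Rightarrow> 'k) q \<longleftrightarrow> p - q \<in> tree_ideal E \<alpha>"
proof -
  interpret I: ideal "tree_ideal E \<alpha>" "poly_ring :: ('v, 'k) tree_poly ring"
    by (rule tree_ideal_ideal)
  have inv: "\<ominus>\<^bsub>poly_ring\<^esub> q = - q" for q :: "('v, 'k) tree_poly"
    by (rule I.minus_equality) auto
  show ?thesis
    unfolding residue_class_def
    using I.quotient_eq_iff_same_a_r_cos[OF tree_ideal_ideal, of p q E \<alpha>] by (simp add: a_minus_def inv)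
qed

lemma residue_class_self: "p \<in> residue_class E \<alpha> p"
proof -
  interpret I: ideal "tree_ideal E \<alpha>" "poly_ring :: ('v, 'k) tree_poly ring"
    by (rule tree_ideal_ideal)
  show ?thesis unfolding residue_class_def by (rule I.a_rcos_self) simp
qed

lemma mem_residue_classD: "q \<in> residue_class E \<alpha> p \<Longrightarrow> residue_class E \<alpha> q = residue_class E \<alpha> p"
  by (auto simp: residue_class_eq_iff) (auto simp: residue_class_def a_r_coset_def r_coset_def)

lemma coord_ring_sel:
  "carrier (coord_ring E \<alpha>) = range (residue_class E \<alpha>)"
  "\<one>\<^bsub>coord_ring E \<alpha>\<^esub> = residue_class E \<alpha> 1"
  "residue_class E \<alpha> p \<otimes>\<^bsub>coord_ring E \<alpha>\<^esub> residue_class E \<alpha> q = residue_class E \<alpha> (p * q)"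
  "residue_class E \<alpha> p \<oplus>\<^bsub>coord_ring E \<alpha>\<^esub> residue_class E \<alpha> q = residue_class E \<alpha> (p + q)"
proof -
  interpret I: ideal "tree_ideal E \<alpha>" "poly_ring :: ('v, 'k) tree_poly ring"
    by (rule tree_ideal_ideal)
  show "carrier (coord_ring E \<alpha>) = range (residue_class E \<alpha>)"
    by (auto simp: coord_ring_def residue_class_def FactRing_def A_RCOSETS_def')
  show "\<one>\<^bsub>coord_ring E \<alpha>\<^esub> = residue_class E \<alpha> 1"
    by (simp add: coord_ring_def residue_class_def FactRing_def)
  show "residue_class E \<alpha> p \<otimes>\<^bsub>coord_ring E \<alpha>\<^esub> residue_class E \<alpha> q = residue_class E \<alpha> (p * q)"
    using I.rcoset_mult_add[of p q] by (simp add: coord_ring_def residue_class_def FactRing_def)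
  show "residue_class E \<alpha> p \<oplus>\<^bsub>coord_ring E \<alpha>\<^esub> residue_class E \<alpha> q = residue_class E \<alpha> (p + q)"
    using I.a_rcos_sum[of p q] by (simp add: coord_ring_def residue_class_def FactRing_def)
qed

end

text \<open>Applying \<open>g\<close> to the hypothesis on \<open>f\<close> shows that
  \<open>g\<close> respects the equations in the other direction, so bijectivity can be checked on
  representatives.\<close>

lemma scheme_iso_of_subst_poly:
  fixes f g :: "'v::finite coord \<Rightarrow> ('v, 'k::field) tree_poly"
  assumes f: "\<And>i. subst_poly f (equation E \<beta> i) = equation E \<alpha> i"
    and fg: "\<And>z. subst_poly f (g z) = var z"
    and gf: "\<And>z. subst_poly g (f z) = var z"
  shows "(\<lambda>C. \<Union>p\<in>C. residue_class E \<alpha> (subst_poly f p)) \<in> scheme_iso E \<alpha> \<beta>"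
proof -
  define h where "h = (\<lambda>C. \<Union>p\<in>C. residue_class E \<alpha> (subst_poly f p))"
  have inverse: "subst_poly f (subst_poly g p) = p" "subst_poly g (subst_poly f p) = p" for p
    by (simp_all add: subst_poly_comp fg gf subst_poly_var_id)
  have g: "subst_poly g (equation E \<alpha> i) = equation E \<beta> i" for i
    by (simp add: inverse flip: f)
  \<comment> \<open>All representatives have the same image class, so the union collapses.\<close>
  have h_class: "h (residue_class E \<beta> p) = residue_class E \<alpha> (subst_poly f p)" for p
  proof -
    have "residue_class E \<alpha> (subst_poly f q) = residue_class E \<alpha> (subst_poly f p)"
      if "q \<in> residue_class E \<beta> p" for q
    proof -
      have "subst_poly f (q - p) \<in> tree_ideal E \<alpha>"
        using f mem_residue_classD[OF that, unfolded residue_class_eq_iff]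
        by (rule subst_poly_tree_ideal)
      then show ?thesis by (simp add: residue_class_eq_iff)
    qed
    then show ?thesis unfolding h_def using residue_class_self[of p E \<beta>] by blast
  qed
  have "inj_on h (carrier (coord_ring E \<beta>))"
  proof (rule inj_onI)
    fix C D
    assume "C \<in> carrier (coord_ring E \<beta>)" "D \<in> carrier (coord_ring E \<beta>)"
    then obtain p q where C: "C = residue_class E \<beta> p" and D: "D = residue_class E \<beta> q"
      by (auto simp only: coord_ring_sel)
    assume "h C = h D"
    then have "h (residue_class E \<beta> p) = h (residue_class E \<beta> q)" by (simp only: C D)
    then have "subst_poly f (p - q) \<in> tree_ideal E \<alpha>"
      by (simp only: h_class residue_class_eq_iff subst_poly_diff)
    then have "subst_poly g (subst_poly f (p - q)) \<in> tree_ideal E \<beta>"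
      by (rule subst_poly_tree_ideal[OF g])
    then have "p - q \<in> tree_ideal E \<beta>" by (simp only: inverse)
    then show "C = D" by (simp only: C D residue_class_eq_iff)
  qed
  moreover have "h ` carrier (coord_ring E \<beta>) = carrier (coord_ring E \<alpha>)"
  proof -
    have "residue_class E \<alpha> p \<in> (\<lambda>q. h (residue_class E \<beta> q)) ` UNIV" for p
      by (rule image_eqI[of _ _ "subst_poly g p"]) (simp_all only: h_class inverse UNIV_I)
    then show ?thesis by (auto simp only: coord_ring_sel image_image h_class)
  qed
  moreover have "h \<in> ring_hom (coord_ring E \<beta>) (coord_ring E \<alpha>)"
    by (rule ring_hom_memI)
      (auto simp only: coord_ring_sel h_class subst_poly_mult subst_poly_add subst_poly_one)
  ultimately show ?thesis
    unfolding h_def[symmetric]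
    by (simp only: scheme_iso_def ring_iso_def bij_betw_def mem_Collect_eq h_class subst_poly_const) simp
qed

text \<open>The two rescalings cancel in \<open>x_v x'_v\<close>. The neighbor product of
  \<open>i\<close> contains \<open>x_v\<close>, once, exactly when \<open>i\<close> is a neighbor of
  \<open>v\<close>, which is where \<open>jump\<close> divides by \<open>\<alpha> u\<close>.\<close>

lemma jump_pullback_scheme_iso:
  fixes \<alpha> :: "'v::finite \<Rightarrow> 'k::field"
  assumes "\<alpha> u \<noteq> 0" "v \<notin> neighbors E v" "u \<in> neighbors E v"
  shows "jump_pullback E u v \<alpha> \<in> scheme_iso E \<alpha> (jump E u v \<alpha>)"
proof -
  define a where "a = \<alpha> u"
  define g where "g z = (if z = Var v then const (inverse a) * var z
      else if z = Var' v then const a * var z else var z)" for z :: "'v coord"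
  have sym: "w \<in> neighbors E x \<longleftrightarrow> x \<in> neighbors E w" for w x
    by (simp add: neighbors_def insert_commute)
  have const_inv: "const a * const (inverse a) = 1" "const (inverse a) * const a = 1"
    using assms(1) by (simp_all add: a_def flip: const_mult)
  have cancel: "const a * (const (inverse a) * p) = p" "const (inverse a) * (const a * p) = p"
    for p :: "('v, 'k) tree_poly"
    by (simp_all add: const_inv flip: mult.assoc)
  let ?f = "jump_subst u v \<alpha>"
  have prod_adj: "(\<Prod>j\<in>neighbors E i. ?f (Var j)) = const a * (\<Prod>j\<in>neighbors E i. var (Var j))"
    if "v \<in> neighbors E i" for i
  proof -
    have "(\<Prod>j\<in>neighbors E i - {v}. ?f (Var j)) = (\<Prod>j\<in>neighbors E i - {v}. var (Var j))"
      by (rule prod.cong) (auto simp: jump_subst_def)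
    then show ?thesis
      using that by (simp add: prod.remove jump_subst_def a_def mult.assoc)
  qed
  have prod_nonadj: "(\<Prod>j\<in>neighbors E i. ?f (Var j)) = (\<Prod>j\<in>neighbors E i. var (Var j))"
    if "v \<notin> neighbors E i" for i
    using that by (intro prod.cong) (auto simp: jump_subst_def)
  have "subst_poly ?f (equation E (jump E u v \<alpha>) i) = equation E \<alpha> i" for i
  proof -
    have "?f (Var i) * ?f (Var' i) = var (Var i) * var (Var' i)"
      using cancel(1) cancel(2)[of "var (Var i) * var (Var' i)"]
      by (simp add: jump_subst_def mult.assoc mult.left_commute flip: a_def)
    moreover have "const (jump E u v \<alpha> i) * (\<Prod>j\<in>neighbors E i. ?f (Var j)) =
        const (\<alpha> i) * (\<Prod>j\<in>neighbors E i. var (Var j))"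
    proof (cases "v \<in> neighbors E i")
      case True
      then have "jump E u v \<alpha> i = \<alpha> i * inverse a"
        using sym by (auto simp: jump_def a_def divide_inverse)
      then show ?thesis
        using cancel by (simp add: prod_adj[OF True] const_mult mult.assoc)
    next
      case False
      then show ?thesis using sym by (simp add: prod_nonadj jump_def)
    qed
    ultimately show ?thesis by (simp add: equation_def)
  qed
  moreover have "subst_poly ?f (g z) = var z" "subst_poly g (?f z) = var z" for z
    using cancel by (simp_all add: g_def jump_subst_def flip: a_def)
  ultimately show ?thesis
    unfolding jump_pullback_def[abs_def] by (rule scheme_iso_of_subst_poly)
qed

lemma scheme_iso_id: "id \<in> scheme_iso E \<alpha> \<alpha>"
  using ring_iso_set_refl by (auto simp: scheme_iso_def)

lemma scheme_iso_comp:
  assumes "h \<in> scheme_iso E \<alpha> \<beta>" "h' \<in> scheme_iso E \<beta> \<gamma>"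
  shows "h \<circ> h' \<in> scheme_iso E \<alpha> \<gamma>"
  using assms ring_iso_set_trans by (fastforce simp: scheme_iso_def)

section \<open>Forests, matchings and colors\<close>

text \<open>Unlike being a tree, this passes to subsets of edges, as the edge-deleting induction in
  \<open>koenig_forest\<close> requires.\<close>

definition forest :: "'v::finite set set \<Rightarrow> bool" where
  "forest E \<longleftrightarrow> (\<forall>e\<in>E. card e = 2) \<and> (\<nexists>p. cycle_in E p)"

lemma forest_mono: "forest E \<Longrightarrow> F \<subseteq> E \<Longrightarrow> forest F"
  unfolding forest_def cycle_in_def by blast

lemma neighbors_sym: "v \<in> neighbors E w \<longleftrightarrow> w \<in> neighbors E v"
  by (simp add: neighbors_def insert_commute)

lemma forest_irrefl: "forest E \<Longrightarrow> {v, w} \<in> E \<Longrightarrow> v \<noteq> w"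
  by (force simp: forest_def)

lemma not_self_neighbor: "forest E \<Longrightarrow> v \<notin> neighbors E v"
  using forest_irrefl[of E v v] by (auto simp: neighbors_def)

lemma forest_edgeE:
  assumes "forest E" "e \<in> E" "v \<in> e"
  obtains w where "e = {v, w}" "v \<noteq> w"
proof -
  have "card e = 2" using assms by (simp add: forest_def)
  then obtain a b where "e = {a, b}" "a \<noteq> b" by (auto simp: card_2_iff)
  with \<open>v \<in> e\<close> that[of a] that[of b] show thesis by (auto simp: insert_commute)
qed

lemma forest_edge_nonempty: "forest E \<Longrightarrow> e \<in> E \<Longrightarrow> e \<noteq> {}"
  by (auto simp: forest_def)

text \<open>
  Otherwise a walk in \<open>S\<close> that never turns back could be continued for ever, and a shortest
  closed piece of it would be a cycle.
\<close>

lemma forest_degenerate: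
  assumes E: "forest E" and "S \<noteq> {}"
  shows "\<exists>v\<in>S. \<forall>a\<in>neighbors E v \<inter> S. \<forall>b\<in>neighbors E v \<inter> S. a = b"
proof (rule ccontr)
  assume no_leaf: "\<not> ?thesis"
  have branch: "\<exists>a b. a \<in> neighbors E v \<inter> S \<and> b \<in> neighbors E v \<inter> S \<and> a \<noteq> b" if "v \<in> S" for v
    using that no_leaf by blast
  \<comment> \<open>The state of the walk is a directed edge: its first end is remembered so that
    the next step can avoid it.\<close>
  have "\<exists>f. \<forall>n. (fst (f n) \<in> S \<and> snd (f n) \<in> neighbors E (fst (f n)) \<inter> S) \<and>
      (fst (f (Suc n)) = snd (f n) \<and> snd (f (Suc n)) \<noteq> fst (f n))"
  proof (rule dependent_nat_choice)
    show "\<exists>x. fst x \<in> S \<and> snd x \<in> neighbors E (fst x) \<inter> S"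
      using \<open>S \<noteq> {}\<close> branch by fastforce
    show "\<exists>y. (fst y \<in> S \<and> snd y \<in> neighbors E (fst y) \<inter> S) \<and> fst y = snd x \<and> snd y \<noteq> fst x"
      if "fst x \<in> S \<and> snd x \<in> neighbors E (fst x) \<inter> S" for x :: "'a \<times> 'a" and n :: nat
    proof -
      from that branch[of "snd x"] obtain a where "a \<in> neighbors E (snd x) \<inter> S" "a \<noteq> fst x"
        by auto
      with that show ?thesis by (intro exI[of _ "(snd x, a)"]) auto
    qed
  qed
  then obtain f where f: "snd (f n) \<in> neighbors E (fst (f n))" "fst (f (Suc n)) = snd (f n)"
    "snd (f (Suc n)) \<noteq> fst (f n)" for n by auto
  define w where "w n = fst (f n)" for n
  have edge: "{w n, w (Suc n)} \<in> E" and turn: "w (Suc (Suc n)) \<noteq> w n" for n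
    using f by (auto simp: w_def neighbors_def)
  have "\<not> inj w"
    using finite_imageD[of w UNIV] by auto
  then have ex: "\<exists>j. \<exists>i<j. w i = w j"
    using linorder_injI[of w] by blast
  \<comment> \<open>The earliest return makes the vertices before it distinct. A return after one
    step would be a loop, and one after two steps a turn back.\<close>
  define j where "j = (LEAST j. \<exists>i<j. w i = w j)"
  have "\<exists>i<j. w i = w j" unfolding j_def by (rule LeastI_ex[OF ex])
  then obtain i where i: "i < j" "w i = w j" by blast
  have least: "w a \<noteq> w b" if "a < b" "b < j" for a b
    using not_less_Least[of b "\<lambda>j. \<exists>i<j. w i = w j"] that unfolding j_def by blast
  have "j \<noteq> Suc i" using forest_irrefl[OF E edge[of i]] i by auto
  moreover have "j \<noteq> Suc (Suc i)" using turn[of i] i by auto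
  ultimately have len: "3 \<le> j - i" using i by linarith
  have "inj_on w {i..<j}"
    using least by (intro linorder_inj_onI) auto
  then have "distinct (map w [i..<j])" by (simp add: distinct_map)
  moreover have "{map w [i..<j] ! k, map w [i..<j] ! (Suc k mod (j - i))} \<in> E" if "k < j - i" for k
  proof (cases "Suc k < j - i")
    case True
    then show ?thesis using edge[of "i + k"] by simp
  next
    case False
    then have k: "Suc k = j - i" using that by linarith
    then have "Suc (i + k) = j" using i by linarith
    then show ?thesis using edge[of "i + k"] k i by simp
  qed
  ultimately have "cycle_in E (map w [i..<j])"
    using len by (simp add: cycle_in_def)
  then show False using E by (auto simp: forest_def)
qed

text \<open>Equivalently, every component can be rooted so that \<open>f\<close> increases towards the root.\<close>

lemma forest_order:
  assumes E: "forest E"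
  obtains f :: "'v::finite \<Rightarrow> nat" where "inj f"
    "\<And>v a b. a \<in> neighbors E v \<Longrightarrow> b \<in> neighbors E v \<Longrightarrow> f v < f a \<Longrightarrow> f v < f b \<Longrightarrow> a = b"
proof -
  have "\<exists>f. inj_on f S \<and> (\<forall>v\<in>S. \<forall>a\<in>neighbors E v \<inter> S. \<forall>b\<in>neighbors E v \<inter> S.
      f v < f a \<longrightarrow> f v < (f b :: nat) \<longrightarrow> a = b)" for S :: "'v set"
  proof (induction "card S" arbitrary: S)
    case 0
    then show ?case by simp
  next
    case (Suc n)
    then have "S \<noteq> {}" by auto
    from forest_degenerate[OF E this] obtain v where v: "v \<in> S"
      "\<forall>a\<in>neighbors E v \<inter> S. \<forall>b\<in>neighbors E v \<inter> S. a = b"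
      by blast
    have "n = card (S - {v})" using Suc(2) v(1) by simp
    from Suc(1)[OF this] obtain f :: "'v \<Rightarrow> nat" where
      f: "inj_on f (S - {v})" "\<forall>u\<in>S - {v}. \<forall>a\<in>neighbors E u \<inter> (S - {v}).
        \<forall>b\<in>neighbors E u \<inter> (S - {v}). f u < f a \<longrightarrow> f u < f b \<longrightarrow> a = b"
      by blast
    \<comment> \<open>The vertex \<open>v\<close>, with at most one neighbor in \<open>S\<close>,
      goes to the bottom: the condition at \<open>v\<close> is then clear, and at other vertices
      \<open>v\<close> is never an upper neighbor.\<close>
    let ?f = "\<lambda>u. if u = v then 0 else Suc (f u)"
    have "inj_on ?f S" using f(1) by (auto simp: inj_on_def)
    moreover have "a = b" if "u \<in> S" "a \<in> neighbors E u \<inter> S" "b \<in> neighbors E u \<inter> S"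
      "?f u < ?f a" "?f u < ?f b" for u a b
    proof (cases "u = v")
      case True
      then show ?thesis using v(2) that(2,3) by blast
    next
      case False
      with that have "a \<noteq> v" "b \<noteq> v" by (auto split: if_splits)
      with that False have "u \<in> S - {v}" "a \<in> neighbors E u \<inter> (S - {v})"
        "b \<in> neighbors E u \<inter> (S - {v})" "f u < f a" "f u < f b"
        by simp_all
      then show ?thesis using f(2) by blast
    qed
    ultimately show ?case by blast
  qed
  from this[of UNIV] obtain f :: "'v \<Rightarrow> nat" where f: "inj f"
    "\<forall>v. \<forall>a\<in>neighbors E v. \<forall>b\<in>neighbors E v. f v < f a \<longrightarrow> f v < f b \<longrightarrow> a = b"
    unfolding Int_UNIV_right by blast
  show thesis by (rule that[OF f(1)]) (use f(2) in blast)
qed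

section \<open>Koenig's theorem and minimum vertex covers\<close>

text \<open>Induction on edges: for a leaf \<open>l\<close> with neighbor \<open>s\<close>, delete
  all edges at \<open>s\<close>, then add the edge to the matching and \<open>s\<close> to the
  cover. The other matching edges avoid \<open>l\<close> because its only edge contains
  \<open>s\<close>.\<close>

lemma koenig_forest:
  assumes "forest E"
  shows "\<exists>M C. matching E M \<and> vertex_cover E C \<and> card C \<le> card M"
  using assms
proof (induction "card E" arbitrary: E rule: less_induct)
  case less
  show ?case
  proof (cases "E = {}")
    case True
    then show ?thesis by (intro exI[of _ "{}"]) (simp add: matching_def vertex_cover_def)
  next
    case False
    then obtain e where e: "e \<in> E" by blast
    with less.prems have "\<Union>E \<noteq> {}"
      using forest_edge_nonempty by blast
    \<comment> \<open>Restricting to \<open>\<Union>E\<close> excludes isolated vertices, so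
      \<open>l\<close> really has an edge.\<close>
    from forest_degenerate[OF less.prems this] obtain l where l: "l \<in> \<Union>E"
      "\<forall>a\<in>neighbors E l \<inter> \<Union>E. \<forall>b\<in>neighbors E l \<inter> \<Union>E. a = b"
      by blast
    from l(1) obtain e' where e': "e' \<in> E" "l \<in> e'" by blast
    obtain s where "e' = {l, s}" "l \<noteq> s" by (rule forest_edgeE[OF less.prems e'])
    with e' have ls: "{l, s} \<in> E" "l \<noteq> s" by simp_all
    have leaf: "e = {l, s}" if e: "e \<in> E" "l \<in> e" for e
    proof -
      obtain t where t: "e = {l, t}" using forest_edgeE[OF less.prems e] .
      have "t \<in> neighbors E l \<inter> \<Union>E" "s \<in> neighbors E l \<inter> \<Union>E"
        using e ls t by (auto simp: neighbors_def)
      then have "t = s" using l(2) by blast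
      then show ?thesis using t by simp
    qed
    let ?F = "{e \<in> E. s \<notin> e}"
    have "{l, s} \<in> E - ?F" using ls(1) by simp
    then have "?F \<noteq> E" by (metis DiffE)
    then have "card ?F < card E" by (intro psubset_card_mono psubsetI) simp_all
    moreover have "forest ?F" using less.prems by (rule forest_mono) auto
    ultimately obtain M C where MC: "matching ?F M" "vertex_cover ?F C" "card C \<le> card M"
      using less.hyps by blast
    have M: "M \<subseteq> ?F" using MC(1) by (simp add: matching_def)
    have "matching E (insert {l, s} M)"
    proof -
      have "d \<inter> {l, s} = {}" if "d \<in> M" for d
        using M that leaf[of d] by blast
      then show ?thesis using MC(1) M ls unfolding matching_def by blast
    qed
    moreover have "vertex_cover E (insert s C)"
      using MC(2) by (auto simp: vertex_cover_def)
    moreover have "card (insert s C) \<le> card (insert {l, s} M)"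
    proof -
      have "{l, s} \<notin> M" using M by blast
      then have "card (insert {l, s} M) = Suc (card M)" by (intro card_insert_disjoint) simp
      moreover have "card (insert s C) \<le> Suc (card C)" by (rule card_insert_le_m1) simp_all
      ultimately show ?thesis using MC(3) by linarith
    qed
    ultimately show ?thesis by (intro exI conjI)
  qed
qed

lemma sum_card_cover_matching:
  assumes "matching E M"
  shows "(\<Sum>e\<in>M. card (C \<inter> e)) = card (C \<inter> \<Union>M)"
proof -
  have "(C \<inter> d) \<inter> (C \<inter> e) = {}" if "d \<in> M" "e \<in> M" "d \<noteq> e" for d e
  proof -
    have "d \<inter> e = {}" using assms that by (simp add: matching_def)
    then show ?thesis by blast
  qed
  then have "card (\<Union>e\<in>M. C \<inter> e) = (\<Sum>e\<in>M. card (C \<inter> e))"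
    by (intro card_UN_disjoint) simp_all
  then show ?thesis by (simp only: Int_Union)
qed

text \<open>\<open>C\<close> needs a vertex on each edge of \<open>M\<close>, and these are distinct
  because the edges are disjoint. Koenig's theorem gives \<open>card C \<le> card M\<close>, so all
  the estimates are equalities.\<close>

lemma min_vertex_cover_matching:
  assumes "forest E" "max_matching E M" "min_vertex_cover E C"
  shows "\<forall>e\<in>M. card (C \<inter> e) = 1" and "C \<subseteq> \<Union>M"
proof -
  from koenig_forest[OF assms(1)] obtain N D where ND: "matching E N" "vertex_cover E D"
    "card D \<le> card N" by blast
  have "card C \<le> card D" using assms(3) ND(2) by (simp add: min_vertex_cover_def)
  also note ND(3)
  also have "card N \<le> card M" using assms(2) ND(1) by (simp add: max_matching_def)
  finally have le: "card C \<le> card M" .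
  have M: "matching E M" using assms(2) by (simp add: max_matching_def)
  have pos: "1 \<le> card (C \<inter> e)" if "e \<in> M" for e
  proof -
    have "e \<in> E" using that M by (auto simp: matching_def)
    then have "e \<inter> C \<noteq> {}"
      using assms(3) by (simp add: min_vertex_cover_def vertex_cover_def)
    then have "C \<inter> e \<noteq> {}" by blast
    then show ?thesis by (simp add: Suc_le_eq card_gt_0_iff)
  qed
  have le_sum: "(\<Sum>e\<in>M. 1) \<le> (\<Sum>e\<in>M. card (C \<inter> e))" using pos by (rule sum_mono)
  have le_C: "card (C \<inter> \<Union>M) \<le> card C" by (rule card_mono) simp_all
  have "card M = (\<Sum>e\<in>M. 1)" by (rule card_eq_sum)
  then have eqs: "(\<Sum>e\<in>M. 1) = (\<Sum>e\<in>M. card (C \<inter> e))" "card (C \<inter> \<Union>M) = card C"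
    using le le_sum le_C unfolding sum_card_cover_matching[OF M] by linarith+
  show "\<forall>e\<in>M. card (C \<inter> e) = 1"
  proof
    fix e
    assume "e \<in> M"
    from sum_mono_inv[OF eqs(1) pos this] show "card (C \<inter> e) = 1" by simp
  qed
  have "C \<inter> \<Union>M = C" using eqs(2) by (intro card_subset_eq) simp_all
  then show "C \<subseteq> \<Union>M" by blast
qed

lemma ex_min_vertex_cover:
  assumes "forest E"
  shows "\<exists>C. min_vertex_cover E C"
proof -
  have "vertex_cover E UNIV"
    using forest_edge_nonempty[OF assms] by (simp add: vertex_cover_def)
  from ex_has_least_nat[of "vertex_cover E", OF this, of card] show ?thesis
    by (simp add: min_vertex_cover_def)
qed

section \<open>Colors, maximum matchings and allowed jumps\<close>

context
  fixes E :: "'v::finite set set"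
  assumes E: "forest E"
begin

lemma red_not_green: "red E v \<Longrightarrow> \<not> green E v"
  using ex_min_vertex_cover[OF E] by (auto simp: red_def green_def)

lemma red_neighbor_green:
  assumes "red E v" "w \<in> neighbors E v"
  shows "green E w"
  unfolding green_def
proof (intro allI impI)
  fix C
  assume C: "min_vertex_cover E C"
  then have "{v, w} \<inter> C \<noteq> {}"
    using assms(2) unfolding min_vertex_cover_def vertex_cover_def neighbors_def by blast
  moreover have "v \<notin> C" using assms(1) C by (simp add: red_def)
  ultimately show "w \<in> C" by blast
qed

text \<open>A jump over \<open>v\<close> affects only neighbors of \<open>v\<close>. If one of them
  is red, then \<open>v\<close> is green, which leaves a single kind of allowed jump.\<close>

lemma jump_allowed_over_neighbor_of_red:
  assumes "jump_allowed E u v" "red E w" "w \<in> neighbors E v"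
  shows "red E u" "green E v"
proof -
  show v: "green E v" using red_neighbor_green assms(2,3) neighbors_sym by metis
  then show "red E u"
    using assms(1) red_not_green
    by (auto simp: jump_allowed_def matched_orange_neighbor_def orange_def green_def)
qed

lemma unmatched_red:
  assumes "max_matching E M" "v \<notin> \<Union>M"
  shows "red E v"
  using min_vertex_cover_matching(2)[OF E assms(1)] assms(2) by (auto simp: red_def)

lemma matched_iff:
  assumes "max_matching E M" "{u, v} \<in> M" "min_vertex_cover E C"
  shows "u \<in> C \<longleftrightarrow> v \<notin> C"
proof -
  have "u \<noteq> v" using assms forest_irrefl[OF E] by (auto simp: max_matching_def matching_def)
  moreover have "card (C \<inter> {u, v}) = 1"
    using min_vertex_cover_matching(1)[OF E assms(1,3)] assms(2) by blast
  ultimately show ?thesis by (cases "u \<in> C"; cases "v \<in> C") auto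
qed

lemma matched_unique:
  assumes "max_matching E M" "{u, v} \<in> M" "{u, w} \<in> M"
  shows "v = w"
proof -
  have "\<forall>d\<in>M. \<forall>e\<in>M. d \<noteq> e \<longrightarrow> d \<inter> e = {}"
    using assms(1) by (simp add: max_matching_def matching_def)
  from this[rule_format, OF assms(2,3)] have "{u, v} = {u, w}" by auto
  then show ?thesis by (auto simp: doubleton_eq_iff)
qed

text \<open>
  The orange vertices with different partners in \<open>M\<close> and \<open>N\<close> are closed under taking both
  partners, so each of them has two neighbors among them, which is impossible in a forest.
\<close>

lemma matched_orange_unique:
  assumes M: "max_matching E M" "{u, v} \<in> M" and N: "max_matching E N" "{u, w} \<in> N"
    and "orange E u"
  shows "v = w"
proof (rule ccontr)
  assume "v \<noteq> w"
  define S where "S = {u. orange E u \<and> (\<exists>v w. {u, v} \<in> M \<and> {u, w} \<in> N \<and> v \<noteq> w)}"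
  have "S \<noteq> {}" using assms \<open>v \<noteq> w\<close> by (auto simp: S_def)
  \<comment> \<open>\<open>A\<close> and \<open>B\<close> stand for \<open>M\<close> and
    \<open>N\<close> in either order, so one argument serves both partners. Orange vertices are not
    red, hence covered by both matchings.\<close>
  have step: "b \<in> S" if max: "max_matching E A" "max_matching E B" and ab: "{a, b} \<in> A"
    and ac: "{a, c} \<in> B" and "b \<noteq> c" and a: "orange E a" and AB: "{A, B} = {M, N}" for A B a b c
  proof -
    have b: "orange E b"
      using a matched_iff[OF max(1) ab] unfolding orange_def by blast
    then have "\<not> red E b" by (auto simp: orange_def red_def)
    then obtain e where e: "e \<in> B" "b \<in> e" using unmatched_red[OF max(2)] by blast
    moreover have "e \<in> E" using e max(2) by (auto simp: max_matching_def matching_def)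
    ultimately obtain d where bd: "{b, d} \<in> B"
      using forest_edgeE[OF E _ e(2)] by metis
    have "d \<noteq> a"
      using matched_unique[OF max(2) ac, of b] bd \<open>b \<noteq> c\<close> by (auto simp: insert_commute)
    moreover have "{b, a} \<in> A" using ab by (simp add: insert_commute)
    moreover from AB have "A = M \<and> B = N \<or> A = N \<and> B = M" by (simp add: doubleton_eq_iff)
    ultimately show ?thesis using b bd unfolding S_def by blast
  qed
  from forest_degenerate[OF E \<open>S \<noteq> {}\<close>] obtain x where x: "x \<in> S"
    "\<forall>a\<in>neighbors E x \<inter> S. \<forall>b\<in>neighbors E x \<inter> S. a = b" by blast
  from x(1) obtain y z where yz: "{x, y} \<in> M" "{x, z} \<in> N" "y \<noteq> z" "orange E x"
    unfolding S_def by blast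
  have "y \<in> S" using step[OF M(1) N(1) yz(1,2)] yz by auto
  moreover have "z \<in> S" using step[OF N(1) M(1) yz(2,1)] yz by auto
  moreover have "y \<in> neighbors E x" "z \<in> neighbors E x"
    using yz M(1) N(1) by (auto simp: neighbors_def max_matching_def matching_def)
  ultimately show False using x(2) yz(3) by blast
qed

text \<open>Every minimum cover contains exactly one end of the edge, so the color of
  \<open>u\<close> determines that of \<open>v\<close>. For orange ends,
  \<open>matched_orange_unique\<close> puts the edge into all maximum matchings.\<close>

lemma matched_jump_allowed:
  assumes M: "max_matching E M" "{u, v} \<in> M"
  shows "jump_allowed E u v"
proof -
  have uv: "{u, v} \<in> E" using M by (auto simp: max_matching_def matching_def)
  note iff = matched_iff[OF M]
  consider "red E u" | "green E u" | "orange E u"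
    by (auto simp: red_def green_def orange_def)
  then show ?thesis
  proof cases
    case 1
    then have "green E v" using iff by (auto simp: red_def green_def)
    then show ?thesis using 1 uv by (simp add: jump_allowed_def)
  next
    case 2
    then have "red E v" using iff by (auto simp: red_def green_def)
    then show ?thesis using 2 uv by (simp add: jump_allowed_def)
  next
    case 3
    then have v: "orange E v" using iff unfolding orange_def by blast
    have "{u, v} \<in> N" if N: "max_matching E N" for N
    proof -
      have "\<not> red E u" using 3 by (auto simp: orange_def red_def)
      then obtain e where e: "e \<in> N" "u \<in> e" using unmatched_red[OF N] by blast
      moreover have "e \<in> E" using e N by (auto simp: max_matching_def matching_def)
      ultimately obtain w where "{u, w} \<in> N"
        using forest_edgeE[OF E] e(2) by metis
      then show ?thesis using matched_orange_unique[OF M N _ 3] by blast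
    qed
    then show ?thesis using 3 v uv by (simp add: jump_allowed_def matched_orange_neighbor_def)
  qed
qed

end

section \<open>The normal form\<close>

lemma jump_params: "\<alpha> \<in> params \<Longrightarrow> jump E u v \<alpha> \<in> params"
  by (simp add: params_def jump_def)

lemma jump_trivial: "\<alpha> u = 1 \<Longrightarrow> jump E u v \<alpha> = \<alpha>"
  by (simp add: jump_def fun_eq_iff)

text \<open>Multiplicativity lets two normal forms be compared through the normal form of the
  quotient of their arguments.\<close>

lemma jump_mult: "jump E u v (\<lambda>i. \<alpha> i * \<beta> i) = (\<lambda>i. jump E u v \<alpha> i * jump E u v \<beta> i)"
  by (simp add: jump_def fun_eq_iff)

definition partner :: "'v set set \<Rightarrow> 'v \<Rightarrow> 'v" where
  "partner M u = (THE v. {u, v} \<in> M)"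

definition jump_onto_partners ::
  "'v::finite set set \<Rightarrow> 'v set set \<Rightarrow> 'v list \<Rightarrow> ('v \<Rightarrow> 'k::field) \<Rightarrow> 'v \<Rightarrow> 'k" where
  "jump_onto_partners E M = fold (\<lambda>u. jump E u (partner M u))"

lemma jump_onto_partners_simps [simp]:
  "jump_onto_partners E M [] \<alpha> = \<alpha>"
  "jump_onto_partners E M (u # us) \<alpha> = jump_onto_partners E M us (jump E u (partner M u) \<alpha>)"
  "jump_onto_partners E M (us @ vs) \<alpha> = jump_onto_partners E M vs (jump_onto_partners E M us \<alpha>)"
  by (simp_all add: jump_onto_partners_def)

lemma jump_onto_partners_params:
  "\<alpha> \<in> params \<Longrightarrow> jump_onto_partners E M us \<alpha> \<in> params"
  by (induction us arbitrary: \<alpha>) (simp_all add: jump_params)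

lemma jump_onto_partners_mult:
  "jump_onto_partners E M us (\<lambda>i. \<alpha> i * \<beta> i) =
    (\<lambda>i. jump_onto_partners E M us \<alpha> i * jump_onto_partners E M us \<beta> i)"
  by (induction us arbitrary: \<alpha> \<beta>) (simp_all add: jump_mult)

lemma jump_onto_partners_trivial:
  "\<forall>u\<in>set us. \<alpha> u = 1 \<Longrightarrow> jump_onto_partners E M us \<alpha> = \<alpha>"
  by (induction us) (simp_all add: jump_trivial)

section \<open>Monic Laurent monomials\<close>

lemma monic_laurent_monomial_proj: "monic_laurent_monomial UNIV (\<lambda>\<alpha> :: 'v::finite \<Rightarrow> 'k::field. \<alpha> i)"
proof -
  have "\<alpha> i = (\<Prod>j\<in>UNIV. \<alpha> j powi (if j = i then 1 else 0))" for \<alpha> :: "'v \<Rightarrow> 'k"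
    by (simp add: if_distrib[of "power_int _"] cong: if_cong)
  then show ?thesis unfolding monic_laurent_monomial_def by (intro exI ballI)
qed

lemma monic_laurent_monomial_divide:
  assumes "monic_laurent_monomial S f" "monic_laurent_monomial S g"
  shows "monic_laurent_monomial S (\<lambda>\<alpha>. f \<alpha> / g \<alpha>)"
proof -
  from assms obtain d e :: "'a \<Rightarrow> int" where
    "\<And>\<alpha>. \<alpha> \<in> params \<Longrightarrow> f \<alpha> = (\<Prod>j\<in>S. \<alpha> j powi d j)"
    "\<And>\<alpha>. \<alpha> \<in> params \<Longrightarrow> g \<alpha> = (\<Prod>j\<in>S. \<alpha> j powi e j)"
    unfolding monic_laurent_monomial_def by blast
  then have "f \<alpha> / g \<alpha> = (\<Prod>j\<in>S. \<alpha> j powi (d j - e j))" if "\<alpha> \<in> params" for \<alpha>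
    using that by (simp add: params_def power_int_diff prod_dividef)
  then show ?thesis unfolding monic_laurent_monomial_def by (intro exI ballI)
qed

text \<open>Induction from the end of the list: the last jump only divides values already known to
  be monomials, so no substitution into monomials occurs.\<close>

lemma monic_laurent_monomial_jump_onto_partners:
  "monic_laurent_monomial UNIV (\<lambda>\<alpha> :: 'v::finite \<Rightarrow> 'k::field. jump_onto_partners E M us \<alpha> i)"
proof (induction us arbitrary: i rule: rev_induct)
  case Nil
  then show ?case by (simp add: monic_laurent_monomial_proj)
next
  case (snoc u us)
  then show ?case
    by (cases "i \<in> neighbors E (partner M u)")
      (simp_all add: jump_def monic_laurent_monomial_divide)
qed

text \<open>The same exponents work: evaluation at the truncated parameter turns the factors outside
  \<open>S\<close> into 1. Exponents are never compared, as over a finite field they are not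
  unique.\<close>

lemma monic_laurent_monomial_restrict:
  fixes f :: "('v::finite \<Rightarrow> 'k::field) \<Rightarrow> 'k"
  assumes "monic_laurent_monomial UNIV f"
    and restrict: "\<And>\<alpha>. \<alpha> \<in> params \<Longrightarrow> f \<alpha> = f (\<lambda>j. if j \<in> S then \<alpha> j else 1)"
  shows "monic_laurent_monomial S f"
proof -
  from assms(1) obtain e where e: "\<And>\<alpha>. \<alpha> \<in> params \<Longrightarrow> f \<alpha> = (\<Prod>j\<in>UNIV. \<alpha> j powi e j)"
    unfolding monic_laurent_monomial_def by blast
  have "f \<alpha> = (\<Prod>j\<in>S. \<alpha> j powi e j)" if "\<alpha> \<in> params" for \<alpha>
  proof -
    let ?\<alpha> = "\<lambda>j. if j \<in> S then \<alpha> j else 1"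
    have "f \<alpha> = f ?\<alpha>" using that by (rule restrict)
    also have "\<dots> = (\<Prod>j\<in>UNIV. ?\<alpha> j powi e j)" using that by (intro e) (simp add: params_def)
    also have "\<dots> = (\<Prod>j\<in>S. ?\<alpha> j powi e j)" by (intro prod.mono_neutral_right) simp_all
    finally show ?thesis by simp
  qed
  then show ?thesis unfolding monic_laurent_monomial_def by (intro exI ballI)
qed

section \<open>Partners, the order of jumps, and red values\<close>

locale matched_forest =
  fixes E :: "'v::finite set set" and M :: "'v set set"
  assumes forest: "forest E" and max: "max_matching E M"
begin

lemma matched_edge: "{u, v} \<in> M \<Longrightarrow> {u, v} \<in> E"
  using max by (auto simp: max_matching_def matching_def)

lemma partner_eq: "{u, v} \<in> M \<Longrightarrow> partner M u = v"
  unfolding partner_def using matched_unique[OF forest max] by (intro the_equality) blast+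

lemma partner_edge:
  assumes "u \<in> \<Union>M"
  shows "{u, partner M u} \<in> M"
proof -
  from assms obtain e where e: "e \<in> M" "u \<in> e" by blast
  then have "e \<in> E" using max by (auto simp: max_matching_def matching_def)
  then obtain w where "e = {u, w}" using forest_edgeE[OF forest _ e(2)] by blast
  then show ?thesis using e partner_eq by simp
qed

lemma partner_involution:
  assumes "u \<in> \<Union>M"
  shows "partner M (partner M u) = u" "partner M u \<in> \<Union>M"
  using partner_edge[OF assms] partner_eq[of "partner M u" u] by (auto simp: insert_commute)

lemma partner_neighbor: "u \<in> \<Union>M \<Longrightarrow> u \<in> neighbors E (partner M u)"
  using matched_edge[OF partner_edge] by (simp add: neighbors_def insert_commute)

lemma partner_jump_allowed: "u \<in> \<Union>M \<Longrightarrow> jump_allowed E u (partner M u)"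
  using matched_jump_allowed[OF forest max partner_edge] .

text \<open>
  The order in which to jump. Call a matched vertex lower if it lies below its partner in the
  rooted forest. Walking from \<open>u\<close> to its partner and on to a different neighbor \<open>w\<close>, one goes up for a
  while and then down: from a lower \<open>u\<close> one reaches a higher lower vertex or an upper vertex, and
  from an upper \<open>u\<close> only upper vertices that lie below \<open>u\<close>.
\<close>

lemma jump_order:
  obtains us where "set us = \<Union>M"
    "\<And>xs u ys w. us = xs @ u # ys \<Longrightarrow> w \<in> set xs \<Longrightarrow> w \<notin> neighbors E (partner M u)"
proof -
  obtain f :: "'v \<Rightarrow> nat" where "inj f" and
    up: "\<And>v a b. a \<in> neighbors E v \<Longrightarrow> b \<in> neighbors E v \<Longrightarrow> f v < f a \<Longrightarrow> f v < f b \<Longrightarrow> a = b"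
    using forest_order[OF forest] by blast
  obtain N where N: "f v < N" for v
  proof
    show "f v < Suc (Max (range f))" for v by (simp add: le_imp_less_Suc)
  qed
  \<comment> \<open>Lower vertices keep their height, which is below \<open>N\<close>; upper ones
    come after them, from top to bottom.\<close>
  define g where "g u = (if f u < f (partner M u) then f u else 2 * N - f u)" for u
  have g: "g u < g w" if u: "u \<in> \<Union>M" and w: "w \<in> \<Union>M" and "w \<noteq> u"
    and uw: "w \<in> neighbors E (partner M u)" for u w
  proof -
    let ?v = "partner M u"
    have vw: "?v \<in> neighbors E w" using uw neighbors_sym by metis
    have pw: "partner M w \<in> neighbors E w" "w \<in> neighbors E (partner M w)"
      using partner_neighbor[OF w] neighbors_sym by metis+
    have uv: "u \<in> neighbors E ?v" using partner_neighbor[OF u] .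
    have "partner M w \<noteq> ?v"
      using partner_involution(1)[OF u] partner_involution(1)[OF w] \<open>w \<noteq> u\<close> by metis
    \<comment> \<open>At most one neighbor of \<open>w\<close> lies above it. If that is
      \<open>?v\<close>, the partner of \<open>w\<close> must lie below.\<close>
    then have upper: "\<not> f w < f (partner M w)" if "f w < f ?v"
      using up[OF vw pw(1)] that by metis
    have neq: "f w \<noteq> f ?v" "f u \<noteq> f ?v"
      using uv uw not_self_neighbor[OF forest, of ?v] inj_eq[OF \<open>inj f\<close>] by metis+
    show ?thesis
    proof (cases "f u < f ?v")
      case True
      with upper neq have "f w < f (partner M w) \<longrightarrow> f u < f w" by linarith
      then show ?thesis using True N[of u] N[of w] by (auto simp: g_def)
    next
      case False
      have "\<not> f ?v < f w" using up[OF uv uw] False neq \<open>w \<noteq> u\<close> by force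
      then show ?thesis using False upper neq N[of u] by (auto simp: g_def)
    qed
  qed
  obtain vs where vs: "set vs = \<Union>M" "distinct vs" using finite_distinct_list[of "\<Union>M"] by auto
  show thesis
  proof
    show "set (sort_key g vs) = \<Union>M" using vs by simp_all
    fix xs u ys w
    assume split: "sort_key g vs = xs @ u # ys" and "w \<in> set xs"
    have "sorted (map g (sort_key g vs))" by simp
    then have "g w \<le> g u" using \<open>w \<in> set xs\<close> by (simp add: split sorted_append)
    moreover have "w \<in> \<Union>M" "u \<in> \<Union>M"
      using vs(1) \<open>w \<in> set xs\<close> arg_cong[OF split, of set] by auto
    moreover have "w \<noteq> u" using vs(2) \<open>w \<in> set xs\<close> split
      by (metis distinct_append distinct_sort disjoint_iff list.set_intros(1))
    ultimately show "w \<notin> neighbors E (partner M u)" using g[of u w] by auto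
  qed
qed

lemma jump_sequence_params:
  "jump_sequence E \<alpha> \<beta> h \<Longrightarrow> \<alpha> \<in> params \<Longrightarrow> \<beta> \<in> params"
  by (induction rule: jump_sequence.induct) (simp_all add: jump_params)

text \<open>Parameters stay nonzero along the sequence, so each rescaling is invertible.\<close>

lemma jump_sequence_scheme_iso:
  "jump_sequence E \<alpha> \<beta> h \<Longrightarrow> \<alpha> \<in> params \<Longrightarrow> h \<in> scheme_iso E \<alpha> \<beta>"
proof (induction rule: jump_sequence.induct)
  case no_jump
  show ?case by (rule scheme_iso_id)
next
  case (one_more_jump \<beta> h u v)
  have "\<beta> u \<noteq> 0" using jump_sequence_params one_more_jump by (auto simp: params_def)
  moreover have "{u, v} \<in> E" using one_more_jump by (simp add: jump_allowed_def)
  moreover have "v \<notin> neighbors E v" by (rule not_self_neighbor[OF forest])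
  ultimately have "jump_pullback E u v \<beta> \<in> scheme_iso E \<beta> (jump E u v \<beta>)"
    by (intro jump_pullback_scheme_iso) (simp_all add: neighbors_def insert_commute)
  then show ?case using one_more_jump by (blast intro: scheme_iso_comp)
qed

lemma jump_onto_partners_sequence:
  assumes "set us \<subseteq> \<Union>M"
  shows "\<exists>h. jump_sequence E \<alpha> (jump_onto_partners E M us \<alpha>) h"
  using assms
proof (induction us rule: rev_induct)
  case Nil
  show ?case using no_jump by (auto intro: exI[of _ id])
next
  case (snoc u us)
  then obtain h where "jump_sequence E \<alpha> (jump_onto_partners E M us \<alpha>) h" by auto
  from one_more_jump[OF this partner_jump_allowed] snoc show ?case by auto
qed

text \<open>
  The values of a parameter on red vertices are changed only by jumps of red vertices over green
  ones, hence inside their own component.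
\<close>

lemma jump_trivial_on_red:
  assumes C: "\<And>v w u. w \<in> C \<Longrightarrow> (w, v) \<in> red_green_edges E \<Longrightarrow> (v, u) \<in> red_green_edges E \<Longrightarrow> u \<in> C"
    and \<alpha>: "\<And>w. w \<in> C \<Longrightarrow> red E w \<Longrightarrow> \<alpha> w = 1"
    and uv: "jump_allowed E u v" and w: "w \<in> C" "red E w"
  shows "jump E u v \<alpha> w = 1"
proof (cases "w \<in> neighbors E v")
  case True
  note u = jump_allowed_over_neighbor_of_red[OF forest uv w(2) True]
  have "{w, v} \<in> E" "{v, u} \<in> E"
    using True uv by (simp_all add: neighbors_def jump_allowed_def insert_commute)
  then have "(w, v) \<in> red_green_edges E" "(v, u) \<in> red_green_edges E"
    using u w(2) by (simp_all add: red_green_edges_def)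
  then have "u \<in> C" using C w(1) by blast
  then show ?thesis using \<alpha> u w by (simp add: jump_def)
next
  case False
  then show ?thesis using \<alpha> w by (simp add: jump_def)
qed

text \<open>Applied both to the whole vertex set and to a red-green component. All red vertices of
  \<open>C\<close> are treated together because a jump affecting one divides by the value at
  another.\<close>

lemma jump_onto_partners_trivial_on_red:
  assumes C: "\<And>v w u. w \<in> C \<Longrightarrow> (w, v) \<in> red_green_edges E \<Longrightarrow> (v, u) \<in> red_green_edges E \<Longrightarrow> u \<in> C"
    and "\<And>w. w \<in> C \<Longrightarrow> red E w \<Longrightarrow> \<alpha> w = 1"
    and "set us \<subseteq> \<Union>M" and "w \<in> C" "red E w"
  shows "jump_onto_partners E M us \<alpha> w = 1"
  using assms(2-)
proof (induction us arbitrary: \<alpha> w)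
  case (Cons u us)
  have "jump E u (partner M u) \<alpha> w = 1" if "w \<in> C" "red E w" for w
  proof (rule jump_trivial_on_red[where C = C])
    show "jump_allowed E u (partner M u)" using partner_jump_allowed Cons.prems(2) by simp
  qed (fact C Cons.prems(1) that)+
  then show ?case using Cons.IH[of "jump E u (partner M u) \<alpha>" w] Cons.prems(2-4) by simp
qed simp

end

section \<open>Existence, uniqueness and dependence of the normal form\<close>

locale ordered_matched_forest = matched_forest E M
  for E :: "'v::finite set set" and M +
  fixes us :: "'v list"
  assumes set_us: "set us = \<Union>M"
    and order: "us = xs @ u # ys \<Longrightarrow> w \<in> set xs \<Longrightarrow> w \<notin> neighbors E (partner M u)"
begin

abbreviation normal_form :: "('v \<Rightarrow> 'k::field) \<Rightarrow> 'v \<Rightarrow> 'k" where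
  "normal_form \<equiv> jump_onto_partners E M us"

text \<open>A jump makes its own vertex 1, this being a neighbor of the partner;
  \<open>order\<close> protects the vertices treated before.\<close>

lemma jump_onto_partners_prefix:
  assumes "us = xs @ ys" "\<alpha> \<in> params" "w \<in> set xs"
  shows "jump_onto_partners E M xs \<alpha> w = 1"
  using assms(1,3)
proof (induction xs arbitrary: ys w rule: rev_induct)
  case (snoc u xs)
  let ?\<beta> = "jump_onto_partners E M xs \<alpha>"
  have u: "u \<in> \<Union>M" using snoc.prems(1) set_us by auto
  have split: "us = xs @ u # ys" using snoc.prems(1) by simp
  show ?case
  proof (cases "w \<in> set xs")
    case True
    then have "?\<beta> w = 1" using snoc.IH[OF split] by blast
    then show ?thesis using order[OF split True] by (simp add: jump_def)
  next
    case False
    have "?\<beta> u \<noteq> 0" using jump_onto_partners_params[OF assms(2)] by (auto simp: params_def)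
    then show ?thesis using False snoc.prems(2) partner_neighbor[OF u] by (simp add: jump_def)
  qed
qed simp

lemma normal_form_one:
  assumes "\<alpha> \<in> params" "\<not> (red E i \<and> i \<notin> \<Union>M)"
  shows "normal_form \<alpha> i = 1"
proof -
  have "i \<in> set us" using assms(2) unmatched_red[OF forest max] set_us by blast
  then show ?thesis using jump_onto_partners_prefix[of us "[]"] assms(1) by simp
qed

lemma normal_form_one_if_red_one:
  assumes "\<alpha> \<in> params" "\<And>i. red E i \<Longrightarrow> \<alpha> i = 1"
  shows "normal_form \<alpha> = (\<lambda>_. 1)"
proof
  fix i
  show "normal_form \<alpha> i = 1"
  proof (cases "red E i")
    case True
    then show ?thesis
      using assms(2) set_us by (intro jump_onto_partners_trivial_on_red[where C = UNIV]) simp_all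
  next
    case False
    then show ?thesis using normal_form_one[OF assms(1)] by blast
  qed
qed

text \<open>
  In the normal form procedure, the partner of \<open>v\<close> comes before all other neighbors of \<open>v\<close>, so
  the first jump that changes anything here is its jump over \<open>v\<close>.
\<close>

lemma normal_form_neighbors:
  fixes a :: "'k::field"
  assumes "v \<in> \<Union>M" "a \<noteq> 0"
  shows "normal_form (\<lambda>i. if i \<in> neighbors E v then a else 1) = (\<lambda>_. 1)"
    (is "normal_form ?\<delta> = _")
proof -
  let ?u = "partner M v"
  have u: "?u \<in> \<Union>M" "partner M ?u = v" using partner_involution[OF assms(1)] by auto
  then obtain xs ys where split: "us = xs @ ?u # ys" using set_us split_list by metis
  have "?\<delta> w = 1" if "w \<in> set xs" for w using order[OF split that] u by simp
  then have "jump_onto_partners E M xs ?\<delta> = ?\<delta>" by (intro jump_onto_partners_trivial) blast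
  \<comment> \<open>The divisor is the value at \<open>?u\<close>, itself a neighbor of
    \<open>v\<close>, so all values \<open>a\<close> become 1 together.\<close>
  moreover have "jump E ?u v ?\<delta> = (\<lambda>_. 1)"
    using partner_neighbor[OF u(1)] u(2) assms(2) by (auto simp: jump_def)
  ultimately have "normal_form ?\<delta> = jump_onto_partners E M ys (\<lambda>_. 1)"
    by (simp add: split u(2))
  then show ?thesis by (simp add: jump_onto_partners_trivial)
qed

text \<open>The jump multiplies \<open>\<alpha>\<close> by \<open>\<delta>\<close>, so it is enough
  that the normal form of \<open>\<delta>\<close> is trivial.\<close>

lemma normal_form_jump:
  fixes \<alpha> :: "'v \<Rightarrow> 'k::field"
  assumes "\<alpha> \<in> params" "jump_allowed E u v"
  shows "normal_form (jump E u v \<alpha>) = normal_form \<alpha>"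
proof -
  define \<delta> where "\<delta> = (\<lambda>i. if i \<in> neighbors E v then inverse (\<alpha> u) else 1)"
  have u: "\<alpha> u \<noteq> 0" using assms(1) by (simp add: params_def)
  have "normal_form \<delta> = (\<lambda>_. 1)"
  proof (cases "v \<in> \<Union>M")
    case True
    then show ?thesis unfolding \<delta>_def using u by (intro normal_form_neighbors) simp_all
  next
    case False
    then have "red E v" using unmatched_red[OF forest max] by blast
    then have "\<not> red E i" if "i \<in> neighbors E v" for i
      using red_neighbor_green[OF forest _ that] red_not_green[OF forest] by blast
    then show ?thesis
      using u by (intro normal_form_one_if_red_one) (auto simp: \<delta>_def params_def)
  qed
  moreover have "jump E u v \<alpha> = (\<lambda>i. \<alpha> i * \<delta> i)"
    by (auto simp: jump_def \<delta>_def divide_inverse)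
  ultimately show ?thesis by (simp add: jump_onto_partners_mult)
qed

lemma normal_form_jump_sequence:
  "jump_sequence E \<alpha> \<beta> h \<Longrightarrow> \<alpha> \<in> params \<Longrightarrow> normal_form \<beta> = normal_form \<alpha>"
proof (induction rule: jump_sequence.induct)
  case (one_more_jump \<beta> h u v)
  then have "\<beta> \<in> params" using jump_sequence_params by blast
  then show ?case using normal_form_jump one_more_jump by metis
qed simp

lemma reduced_form_normal_form:
  assumes "\<alpha> \<in> params"
  shows "reduced_form E M \<alpha> (normal_form \<alpha>)"
proof -
  obtain h where "jump_sequence E \<alpha> (normal_form \<alpha>) h"
    using jump_onto_partners_sequence[OF equalityD1[OF set_us]] by blast
  then have "iso_by_jumps E \<alpha> (normal_form \<alpha>)"
    using jump_sequence_scheme_iso[OF _ assms] by (auto simp: iso_by_jumps_def)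
  then show ?thesis
    unfolding reduced_form_def
    using jump_onto_partners_params[OF assms] normal_form_one[OF assms] by blast
qed

text \<open>The normal form is invariant along jump sequences, and a reduced \<open>\<beta>\<close>
  is its own normal form, since it is 1 at every vertex that jumps.\<close>

lemma reduced_form_unique:
  assumes "\<alpha> \<in> params" "reduced_form E M \<alpha> \<beta>"
  shows "\<beta> = normal_form \<alpha>"
proof -
  obtain h where "jump_sequence E \<alpha> \<beta> h"
    using assms(2) by (auto simp: reduced_form_def iso_by_jumps_def)
  then have "normal_form \<beta> = normal_form \<alpha>" using normal_form_jump_sequence assms(1) by blast
  moreover have "normal_form \<beta> = \<beta>"
    using assms(2) set_us by (intro jump_onto_partners_trivial) (simp add: reduced_form_def)
  ultimately show ?thesis by simp
qed

lemma normal_form_cong_red: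
  fixes \<alpha> \<alpha>' :: "'v \<Rightarrow> 'k::field"
  assumes "\<alpha> \<in> params" "\<alpha>' \<in> params" "\<And>i. red E i \<Longrightarrow> \<alpha> i = \<alpha>' i"
  shows "normal_form \<alpha> = normal_form \<alpha>'"
proof -
  define \<gamma> where "\<gamma> = (\<lambda>i. \<alpha> i / \<alpha>' i)"
  have "normal_form \<gamma> = (\<lambda>_. 1)"
    using assms by (intro normal_form_one_if_red_one) (simp_all add: params_def \<gamma>_def)
  moreover have "\<alpha> = (\<lambda>i. \<alpha>' i * \<gamma> i)" using assms(2) by (simp add: params_def \<gamma>_def)
  ultimately show ?thesis by (simp add: jump_onto_partners_mult)
qed

text \<open>Factor \<open>\<alpha>\<close> into its parts on and off \<open>C\<close>. The second is
  1 on \<open>C\<close>, and jumps preserve this at red vertices of \<open>C\<close>; at the other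
  vertices the normal form is 1 anyway.\<close>

lemma normal_form_component:
  assumes C: "C \<in> red_green_components E" and "i \<in> C"
  shows "monic_laurent_monomial C (\<lambda>\<alpha> :: 'v \<Rightarrow> 'k::field. normal_form \<alpha> i)"
proof (rule monic_laurent_monomial_restrict[OF monic_laurent_monomial_jump_onto_partners])
  fix \<alpha> :: "'v \<Rightarrow> 'k"
  assume \<alpha>: "\<alpha> \<in> params"
  let ?\<alpha> = "\<lambda>j. if j \<in> C then \<alpha> j else 1" and ?\<beta> = "\<lambda>j. if j \<in> C then 1 else \<alpha> j"
  have params: "?\<alpha> \<in> params" using \<alpha> by (simp add: params_def)
  show "normal_form \<alpha> i = normal_form ?\<alpha> i"
  proof (cases "red E i")
    case True
    have "normal_form ?\<beta> i = 1"
    proof (rule jump_onto_partners_trivial_on_red[where C = C])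
      fix v w u
      assume "w \<in> C" "(w, v) \<in> red_green_edges E" "(v, u) \<in> red_green_edges E"
      then show "u \<in> C"
        using C by (auto simp: red_green_components_def intro: rtrancl_into_rtrancl)
    qed (use True \<open>i \<in> C\<close> set_us in simp_all)
    moreover have "\<alpha> = (\<lambda>j. ?\<alpha> j * ?\<beta> j)" by auto
    then have "normal_form \<alpha> i = normal_form ?\<alpha> i * normal_form ?\<beta> i"
      using jump_onto_partners_mult[of E M us ?\<alpha> ?\<beta>] by metis
    ultimately show ?thesis by simp
  next
    case False
    then show ?thesis using normal_form_one[OF \<alpha>, of i] normal_form_one[OF params, of i] by simp
  qed
qed

end

theorem proposition2p2:
  fixes E :: "'v::finite set set" and M :: "'v set set"
  assumes "is_tree E" and "max_matching E M"
  shows "\<exists>B :: ('v \<Rightarrow> 'k::field) \<Rightarrow> 'v \<Rightarrow> 'k.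
    (\<forall>\<alpha>\<in>params. reduced_form E M \<alpha> (B \<alpha>) \<and> (\<exists>!\<beta>. reduced_form E M \<alpha> \<beta>)) \<and>
    (\<forall>i. monic_laurent_monomial UNIV (\<lambda>\<alpha>. B \<alpha> i)) \<and>
    (\<forall>\<alpha>\<in>params. \<forall>\<alpha>'\<in>params. (\<forall>i. red E i \<longrightarrow> \<alpha> i = \<alpha>' i) \<longrightarrow> B \<alpha> = B \<alpha>') \<and>
    (\<forall>C\<in>red_green_components E. \<forall>i\<in>C. monic_laurent_monomial C (\<lambda>\<alpha>. B \<alpha> i))"
proof -
  have "forest E" using assms(1) by (simp add: is_tree_def forest_def)
  then interpret matched_forest E M using assms(2) by unfold_locales
  \<comment> \<open>The list is chosen from \<open>E\<close> and \<open>M\<close> alone, so one map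
    with fixed exponents serves all parameters.\<close>
  obtain us where "set us = \<Union>M"
    "\<And>xs u ys w. us = xs @ u # ys \<Longrightarrow> w \<in> set xs \<Longrightarrow> w \<notin> neighbors E (partner M u)"
    using jump_order by blast
  then interpret ordered_matched_forest E M us by unfold_locales
  show ?thesis
  proof (intro exI[of _ normal_form] conjI ballI allI impI)
    fix \<alpha> :: "'v \<Rightarrow> 'k"
    assume \<alpha>: "\<alpha> \<in> params"
    show "reduced_form E M \<alpha> (normal_form \<alpha>)" using \<alpha> by (rule reduced_form_normal_form)
    then show "\<exists>!\<beta>. reduced_form E M \<alpha> \<beta>" using reduced_form_unique[OF \<alpha>] by (rule ex1I)
  next
    fix \<alpha> \<alpha>' :: "'v \<Rightarrow> 'k"
    assume "\<alpha> \<in> params" "\<alpha>' \<in> params" "\<forall>i. red E i \<longrightarrow> \<alpha> i = \<alpha>' i"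
    then show "normal_form \<alpha> = normal_form \<alpha>'" using normal_form_cong_red by blast
  qed (fact monic_laurent_monomial_jump_onto_partners, rule normal_form_component)
qed

end
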